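(* Let $P\in C^2(\mathbb{R}^n,\mathbb{R}^n)$, $Q\in C^1(\mathbb{R}^n\times[0,1],\mathbb{R}^n)$ and $\Phi(v,\varepsilon)=P(v)+\varepsilon Q(v,\varepsilon)$. Let $v_0\in\mathbb{R}^n$ be such that $P(v_0)=0$, the matrix $P'(v_0)$ is singular, and zero is a simple eigenvalue of $P'(v_0)$. Assume that $v_0=x(\theta_0)$, where $\theta\mapsto x(\theta)\in\mathbb{R}^n$ is a $C^2$-parametrized curve of zeros of $P$. Let $\Pi:\mathbb{R}^n\to\mathbb{R}^n$ be a linear projector invariant with respect to $P'(v_0)$ with $\Pi P'(v_0)=0$, such that $P'(v_0)|_{(I-\Pi)\mathbb{R}^n}:(I-\Pi)\mathbb{R}^n\to(I-\Pi)\mathbb{R}^n$ is invertible. Assume that $\Pi Q(v_0,0)=0$, that $\Pi P''(v_0)(\Pi r)(\Pi s)=0$ for all $r,s\in\mathbb{R}^n$, and that the operator $$h\mapsto-\Pi P''(v_0)\Big[(I-\Pi)\big(P'(v_0)|_{(I-\Pi)\mathbb{R}^n}\big)^{-1}Q(v_0,0)\Big]h+\Pi Q'_v(v_0,0)h$$ is invertible on $\Pi\mathbb{R}^n$. Let $w_0$, the family $\{w_\varepsilon\}$ and the family $\{\lambda_\varepsilon\}$ (for $\varepsilon>0$ small) be as described in the context: $w_0$ is the unique zero of $\Psi(\cdot,0)$, $\Psi(w_\varepsilon,\varepsilon)=0$ with $w_\varepsilon\to w_0$ as $\varepsilon\to0$, and $\lambda_\varepsilon$ is an eigenvalue of $\Phi'_v(v_0+\varepsilon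 w_\varepsilon,\varepsilon)$ with $\lambda_\varepsilon\to0$ as $\varepsilon\to0$. Let $\lambda_*\in\mathbb{R}$ be the eigenvalue of the operator $$\Pi P''(v_0)w_0\big|_{\Pi\mathbb{R}^n}+\Pi Q'_v(v_0,0)\big|_{\Pi\mathbb{R}^n}:\Pi\mathbb{R}^n\to\Pi\mathbb{R}^n .$$ Then $$\lambda_\varepsilon=\varepsilon\lambda_*+o(\varepsilon)\quad\text{as }\varepsilon\to0^+.$$
   Context: $P'(v_0)$ is the Jacobian matrix of $P$ at $v_0$; $P''(v_0)ab$ is the second derivative of $P$ at $v_0$ applied to $(a,b)$, and $P''(v_0)w$ denotes the linear map $h\mapsto P''(v_0)wh$. $Q'_v$, $Q'_\varepsilon$, $\Phi'_v$ denote partial derivatives. A linear projector $\Pi$ is invariant with respect to $P'(v_0)$ if both $\mathrm{Im}\,\Pi$ and $\mathrm{Ker}\,\Pi$ are invariant subspaces of $P'(v_0)$. Under the stated hypotheses $\Pi\mathbb{R}^n=\mathrm{Ker}\,P'(v_0)$ is one-dimensional, so the operator on $\Pi\mathbb{R}^n$ defining $\lambda_*$ has exactly one eigenvalue. The function $\Psi$ is defined for $w\in\mathbb{R}^n$ and $\varepsilon\in(0,1]$ by $$\Psi(w,\varepsilon)=\frac1\varepsilon\Big(\Phi(v_0+\varepsilon w,\varepsilon)-\Pi\Phi(v_0+\varepsilon w,\varepsilon)+\frac1\varepsilon\Pi\Phi(v_0+\varepsilon w,\varepsilon)\Big),$$ and for $\varepsilon=0$ by $$\Psi(w,0)=\tfrac12\Pi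 P''(v_0)ww+\Pi Q'_v(v_0,0)w+\Pi Q'_\varepsilon(v_0,0)+(I-\Pi)P'(v_0)w+(I-\Pi)Q(v_0,0).$$ Under the stated hypotheses there is a unique $w_0\in\mathbb{R}^n$ with $\Psi(w_0,0)=0$, and $\Psi'_w(w_0,0)$ is non-singular; $\{w_\varepsilon\}$ denotes the family of zeros, $\Psi(w_\varepsilon,\varepsilon)=0$ for all sufficiently small $\varepsilon>0$, with $w_\varepsilon\to w_0$ as $\varepsilon\to0$, given by the implicit function theorem. Since $\Phi'_v(v_0+\varepsilon w_\varepsilon,\varepsilon)\to P'(v_0)$ as $\varepsilon\to0$, for all small $\varepsilon>0$ there is an eigenvalue $\lambda_\varepsilon$ of $\Phi'_v(v_0+\varepsilon w_\varepsilon,\varepsilon)$ such that $\lambda_\varepsilon\to0$ as $\varepsilon\to0$. *)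

theory Defs
  imports
    "HOL-Analysis.Analysis"
    "HOL-Computational_Algebra.Polynomial"
    "HOL-Library.Landau_Symbols"
begin

text \<open>
  Derivatives are taken relative to a set, so that they are one-sided at boundary points.
  The Frechet derivative is the unique one on all the sets on which it is used here: the whole
  space, nondegenerate real intervals, and the product of \<open>UNIV\<close> with such an interval.
\<close>

definition fderiv ::
  "('a::real_normed_vector \<Rightarrow> 'b::real_normed_vector) \<Rightarrow> 'a set \<Rightarrow> 'a \<Rightarrow> 'a \<Rightarrow>\<^sub>L 'b"
  where "fderiv f S x = Blinfun (frechet_derivative f (at x within S))"

definition C1_on :: "'a::real_normed_vector set \<Rightarrow> ('a \<Rightarrow> 'b::real_normed_vector) \<Rightarrow> bool"
  where "C1_on S f \<longleftrightarrow> f differentiable_on S \<and> continuous_on S (fderiv f S)"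

definition C2_on :: "'a::real_normed_vector set \<Rightarrow> ('a \<Rightarrow> 'b::real_normed_vector) \<Rightarrow> bool"
  where "C2_on S f \<longleftrightarrow> f differentiable_on S \<and> C1_on S (fderiv f S)"

definition second_deriv ::
  "('a::real_normed_vector \<Rightarrow> 'b::real_normed_vector) \<Rightarrow> 'a \<Rightarrow> 'a \<Rightarrow> 'a \<Rightarrow> 'b"
  where "second_deriv f x a b = blinfun_apply (blinfun_apply (fderiv (fderiv f UNIV) UNIV x) a) b"

lemma has_derivative_fderiv:
  assumes "f differentiable_on S" "x \<in> S"
  shows "(f has_derivative blinfun_apply (fderiv f S x)) (at x within S)"
proof -
  have d: "(f has_derivative frechet_derivative f (at x within S)) (at x within S)"
    using assms by (simp add: differentiable_on_def frechet_derivative_works)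
  then have "bounded_linear (frechet_derivative f (at x within S))"
    by (rule has_derivative_bounded_linear)
  then show ?thesis
    using d by (simp add: fderiv_def bounded_linear_Blinfun_apply)
qed

definition mat_eigenvalue :: "'k::field^'n^'n \<Rightarrow> 'k \<Rightarrow> bool"
  where "mat_eigenvalue A c \<longleftrightarrow> (\<exists>h. h \<noteq> 0 \<and> A *v h = c *s h)"

definition char_polynomial :: "'k::field^'n^'n \<Rightarrow> 'k poly"
  where "char_polynomial A = det (mat [:0, 1:] - map_matrix (\<lambda>a. [:a:]) A)"

text \<open>Simple means of algebraic multiplicity one.\<close>

definition simple_mat_eigenvalue :: "'k::field^'n^'n \<Rightarrow> 'k \<Rightarrow> bool"
  where "simple_mat_eigenvalue A c \<longleftrightarrow> mat_eigenvalue A c \<and> order c (char_polynomial A) = 1"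

definition eigenvalue_on :: "'a::real_vector set \<Rightarrow> ('a \<Rightarrow> 'a) \<Rightarrow> real \<Rightarrow> bool"
  where "eigenvalue_on V T c \<longleftrightarrow> (\<exists>h\<in>V. h \<noteq> 0 \<and> T h = c *\<^sub>R h)"

definition linear_projector :: "('a::real_vector \<Rightarrow> 'a) \<Rightarrow> bool"
  where "linear_projector p \<longleftrightarrow> linear p \<and> p \<circ> p = p"

definition invariant_projector :: "('a::real_vector \<Rightarrow> 'a) \<Rightarrow> ('a \<Rightarrow> 'a) \<Rightarrow> bool"
  where "invariant_projector p T \<longleftrightarrow>
    linear_projector p \<and> T ` range p \<subseteq> range p \<and> T ` {x. p x = 0} \<subseteq> {x. p x = 0}"

definition complement_proj :: "('a::real_vector \<Rightarrow> 'a) \<Rightarrow> 'a \<Rightarrow> 'a"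
  where "complement_proj p x = x - p x"

definition Phi ::
  "(real^'n \<Rightarrow> real^'n) \<Rightarrow> ((real^'n) \<times> real \<Rightarrow> real^'n) \<Rightarrow> real^'n \<Rightarrow> real \<Rightarrow> real^'n"
  where "Phi P Q v \<epsilon> = P v + \<epsilon> *\<^sub>R Q (v, \<epsilon>)"

definition Q_v :: "((real^'n) \<times> real \<Rightarrow> real^'n) \<Rightarrow> real^'n \<Rightarrow> real \<Rightarrow> real^'n^'n"
  where "Q_v Q v \<epsilon> = jacobian (\<lambda>u. Q (u, \<epsilon>)) (at v)"

definition Q_eps :: "((real^'n) \<times> real \<Rightarrow> real^'n) \<Rightarrow> real^'n \<Rightarrow> real \<Rightarrow> real^'n"
  where "Q_eps Q v \<epsilon> = vector_derivative (\<lambda>s. Q (v, s)) (at \<epsilon> within {0..1})"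

definition Phi_v ::
  "(real^'n \<Rightarrow> real^'n) \<Rightarrow> ((real^'n) \<times> real \<Rightarrow> real^'n) \<Rightarrow> real^'n \<Rightarrow> real \<Rightarrow> real^'n^'n"
  where "Phi_v P Q v \<epsilon> = jacobian (\<lambda>u. Phi P Q u \<epsilon>) (at v)"

definition Psi ::
  "(real^'n \<Rightarrow> real^'n) \<Rightarrow> ((real^'n) \<times> real \<Rightarrow> real^'n) \<Rightarrow> (real^'n \<Rightarrow> real^'n) \<Rightarrow> real^'n
    \<Rightarrow> real^'n \<Rightarrow> real \<Rightarrow> real^'n"
  where "Psi P Q p v0 w \<epsilon> =
    (if \<epsilon> = 0 then
       (1/2) *\<^sub>R p (second_deriv P v0 w w) + p (Q_v Q v0 0 *v w) + p (Q_eps Q v0 0)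
       + complement_proj p (jacobian P (at v0) *v w) + complement_proj p (Q (v0, 0))
     else
       (1/\<epsilon>) *\<^sub>R (Phi P Q (v0 + \<epsilon> *\<^sub>R w) \<epsilon> - p (Phi P Q (v0 + \<epsilon> *\<^sub>R w) \<epsilon>)
                  + (1/\<epsilon>) *\<^sub>R p (Phi P Q (v0 + \<epsilon> *\<^sub>R w) \<epsilon>)))"

end

theory Submission
  imports Defs
begin

text \<open>
  Write \<open>\<Phi>'\<^sub>v (v\<^sub>0 + \<epsilon> w\<^sub>\<epsilon>, \<epsilon>) = A + \<epsilon> B\<^sub>\<epsilon>\<close> with \<open>A = P' v\<^sub>0\<close>; differentiability of \<open>P'\<close> at \<open>v\<^sub>0\<close> gives
  \<open>B\<^sub>\<epsilon> \<rightarrow> B\<^sub>0 = P'' v\<^sub>0 w\<^sub>0 + Q'\<^sub>v (v\<^sub>0, 0)\<close>. Simplicity of the eigenvalue \<open>0\<close> makes the range of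
  \<open>\<Pi>\<close> a line spanned by some \<open>e\<close>, so \<open>\<Pi> h = \<phi> h e\<close> with a functional \<open>\<phi>\<close> that vanishes on the range of \<open>A\<close>.
  As \<open>A\<close> is bounded below on the kernel of \<open>\<phi>\<close>, an eigenvector \<open>h\<^sub>\<epsilon>\<close> for \<open>\<lambda>\<^sub>\<epsilon>\<close> can be
  normalised by \<open>\<phi> h\<^sub>\<epsilon> = 1\<close> and then tends to \<open>e\<close>. Applying \<open>\<phi>\<close> to the eigenvalue equation gives
  \<open>\<lambda>\<^sub>\<epsilon> = \<epsilon> \<phi> (B\<^sub>\<epsilon> h\<^sub>\<epsilon>)\<close>, and \<open>\<phi> (B\<^sub>\<epsilon> h\<^sub>\<epsilon>) \<rightarrow> \<phi> (B\<^sub>0 e) = \<lambda>\<^sub>*\<close>.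
\<close>

section \<open>Characteristic polynomials and eigenspaces of simple eigenvalues\<close>

lemma poly_det:
  fixes M :: "'k::comm_ring_1 poly^'n^'n"
  shows "poly (det M) t = det (map_matrix (\<lambda>p. poly p t) M)"
  by (simp add: det_def poly_sum poly_prod map_matrix_def)

lemma poly_char_polynomial:
  "poly (char_polynomial A) t = det (mat t - A)"
proof -
  have "map_matrix (\<lambda>p. poly p t) (mat [:0, 1:] - map_matrix (\<lambda>a. [:a:]) A) = mat t - A"
    by (simp add: vec_eq_iff mat_def map_matrix_def)
  then show ?thesis
    by (simp add: char_polynomial_def poly_det)
qed

text \<open>For \<open>t\<close> beyond a norm bound of \<open>A\<close>, \<open>mat t - A\<close>
  has trivial kernel, so the polynomial does not vanish at \<open>t\<close>. This lets
  \<open>order\<close> be read off from divisibility.\<close>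

lemma char_polynomial_nonzero:
  fixes A :: "real^'n^'n"
  shows "char_polynomial A \<noteq> 0"
proof -
  obtain K where K: "\<And>h. norm (A *v h) \<le> norm h * K"
    using bounded_linear.bounded matrix_vector_mul_bounded_linear by blast
  define t where "t = \<bar>K\<bar> + 1"
  have "h = 0" if "(mat t - A) *v h = 0" for h
  proof -
    have "mat t *v h = t *\<^sub>R h"
      by (simp add: vec_eq_iff matrix_vector_mult_def mat_def if_distrib[of "\<lambda>a. a * _"] cong: if_cong)
    then have "A *v h = t *\<^sub>R h"
      using that by (simp add: matrix_vector_mult_diff_rdistrib)
    then have "t * norm h \<le> norm h * K"
      using K[of h] by (simp add: t_def)
    then have "(t - K) * norm h \<le> 0"
      by (simp add: algebra_simps)
    moreover have "t - K > 0"
      by (simp add: t_def)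
    ultimately show "h = 0"
      by (simp add: mult_le_0_iff)
  qed
  then have "invertible (mat t - A)"
    by (simp add: invertible_left_inverse matrix_left_invertible_ker)
  then have "poly (char_polynomial A) t \<noteq> 0"
    by (simp add: poly_char_polynomial invertible_det_nz)
  then show ?thesis
    by auto
qed

text \<open>A basis extending the two vectors has as many elements as the index type and can be
  listed as rows. Rows are chosen because \<open>det_row_mul\<close> extracts factors from
  rows.\<close>

lemma ex_nonsingular_rows:
  fixes e g :: "real^'n"
  assumes "independent {e, g}" "e \<noteq> g"
  obtains S :: "real^'n^'n" and i j where "i \<noteq> j" "S $ i = e" "S $ j = g" "det S \<noteq> 0"
proof -
  obtain B where B: "{e, g} \<subseteq> B" "independent B" "UNIV \<subseteq> span B"
    using maximal_independent_subset_extend[OF subset_UNIV assms(1)] by metis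
  have "finite B"
    using B(2) by (rule independent_imp_finite)
  have "card B = CARD('n)"
    using basis_card_eq_dim[OF subset_UNIV B(3,2)] by simp
  then obtain f where f: "bij_betw f (UNIV :: 'n set) B"
    using \<open>finite B\<close> finite_same_card_bij[of "UNIV :: 'n set" B] by auto
  define S where "S = (\<chi> k. f k)"
  have rows: "rows S = B"
    using bij_betw_imp_surj_on[OF f] by (auto simp: rows_def row_def S_def)
  have "invertible S"
    using B(3) by (simp add: top.extremum_unique rows matrix_left_invertible_span_rows invertible_left_inverse)
  moreover obtain i j where "f i = e" "f j = g"
    using B(1) bij_betw_imp_surj_on[OF f] by blast
  ultimately show thesis
    using that[of i j S] assms(2) by (auto simp: S_def invertible_det_nz)
qed

text \<open>Geometric multiplicity is at most algebraic multiplicity: two independent eigenvectors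
  would make \<open>c\<close> a double root of the characteristic polynomial.\<close>

lemma simple_mat_eigenvalue_eigenspace:
  fixes A :: "real^'n^'n"
  assumes simple: "simple_mat_eigenvalue A c"
    and e: "A *v e = c *s e" "e \<noteq> 0" and g: "A *v g = c *s g"
  shows "g \<in> span {e}"
proof (rule ccontr)
  assume "g \<notin> span {e}"
  then have "independent {e, g}" "e \<noteq> g"
    using e(2) independent_insertI[of g "{e}"] by (auto simp: insert_commute span_base)
  then obtain S :: "real^'n^'n" and i j
    where S: "i \<noteq> j" "S $ i = e" "S $ j = g" "det S \<noteq> 0"
    by (rule ex_nonsingular_rows)
  let ?C = "\<lambda>a::real. [:a:]"
  \<comment> \<open>The rows of \<open>N\<close> are \<open>(X - A)\<close> applied to the rows of \<open>S\<close>; the rows \<open>i\<close> and \<open>j\<close> each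
    contribute a factor \<open>X - c\<close> to the determinant, so \<open>c\<close> is at least a double root.\<close>
  define N where "N = map_matrix ?C S ** transpose (mat [:0, 1:] - map_matrix ?C A)"
  \<comment> \<open>\<open>R\<close> is \<open>N\<close> with the factor \<open>X - c\<close>
    divided out of rows \<open>i\<close> and \<open>j\<close>.\<close>
  define R where "R = (\<chi> k. if k = i \<or> k = j then map_matrix ?C S $ k else N $ k)"
  have C_sum: "(\<Sum>l\<in>UNIV. [:a l:] * [:b l:]) = [:\<Sum>l\<in>UNIV. a l * b l:]" for a b :: "'n \<Rightarrow> real"
    by (induction rule: infinite_finite_induct) (auto simp: mult.commute)
  have N_row: "N $ k $ l = [:0, 1:] * [:S $ k $ l:] - [:(A *v S $ k) $ l:]" for k l
  proof -
    have "N $ k $ l = (\<Sum>m\<in>UNIV. [:S $ k $ m:] * ((if l = m then [:0, 1:] else 0) - [:A $ l $ m:]))"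
      by (simp add: N_def matrix_matrix_mult_def transpose_def mat_def map_matrix_def)
    also have "\<dots> = (\<Sum>m\<in>UNIV. if l = m then [:0, 1:] * [:S $ k $ m:] else 0)
        - (\<Sum>m\<in>UNIV. [:A $ l $ m:] * [:S $ k $ m:])"
      unfolding sum_subtractf[symmetric] by (rule sum.cong) (auto simp: algebra_simps)
    finally show ?thesis
      unfolding C_sum by (simp add: matrix_vector_mult_def)
  qed
  have N_scaled: "N $ k = [:- c, 1:] *s R $ k" if "k = i \<or> k = j" for k
  proof -
    have "A *v S $ k = c *s S $ k"
      using that S e g by auto
    then show ?thesis
      using that by (auto simp: vec_eq_iff N_row R_def map_matrix_def)
  qed
  have "N = (\<chi> k. if k = i then [:- c, 1:] *s R $ k
      else (\<chi> k. if k = j then [:- c, 1:] *s R $ k else R $ k) $ k)"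
    using S(1) N_scaled by (subst vec_eq_iff) (auto simp: R_def)
  also have "det \<dots> = [:- c, 1:] * det (\<chi> k. if k = i then R $ k
      else (\<chi> k. if k = j then [:- c, 1:] *s R $ k else R $ k) $ k)"
    by (rule det_row_mul)
  also have "(\<chi> k. if k = i then R $ k
      else (\<chi> k. if k = j then [:- c, 1:] *s R $ k else R $ k) $ k)
      = (\<chi> k. if k = j then [:- c, 1:] *s R $ k else R $ k)"
    using S(1) by (auto simp: vec_eq_iff)
  also have "det \<dots> = [:- c, 1:] * det (\<chi> k. if k = j then R $ k else R $ k)"
    by (rule det_row_mul)
  finally have "[:- c, 1:] ^ 2 dvd det N"
    by (simp only: power2_eq_square dvd_triv_left flip: mult.assoc)
  \<comment> \<open>As \<open>det S\<close> is a nonzero constant, the double factor of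
    \<open>det N\<close> passes to the characteristic polynomial.\<close>
  moreover have "det N = [:det S:] * char_polynomial A"
  proof -
    have "det (map_matrix ?C S) = [:det S:]"
    proof -
      have "(\<Prod>k\<in>UNIV. [:S $ k $ p k:]) = [:\<Prod>k\<in>UNIV. S $ k $ p k:]" for p
        by (induction rule: infinite_finite_induct) (auto simp: mult.commute)
      moreover have "(\<Sum>p\<in>X. [:a p:]) = [:\<Sum>p\<in>X. a p:]" for X and a :: "('n \<Rightarrow> 'n) \<Rightarrow> real"
        by (induction rule: infinite_finite_induct) auto
      ultimately show ?thesis
        by (simp add: det_def map_matrix_def of_int_poly mult.commute)
    qed
    then show ?thesis
      by (simp add: N_def det_mul char_polynomial_def)
  qed
  ultimately have "[:- c, 1:] ^ 2 dvd char_polynomial A"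
    using S(4) by (simp add: dvd_smult_iff)
  then have "2 \<le> order c (char_polynomial A)"
    using char_polynomial_nonzero[of A] by (simp only: order_divides simp_thms)
  then show False
    using simple by (simp add: simple_mat_eigenvalue_def)
qed

section \<open>First-order perturbation of a simple zero eigenvalue\<close>

text \<open>Here \<open>e\<close> and \<phi> are right and left null vectors of \<open>A\<close>.
  The eigenvalue may be complex, so its eigenvector enters through real and imaginary parts
  \<open>x\<close> and \<open>y\<close>, which keeps all operators real.\<close>

lemma simple_eigenvalue_perturbation:
  fixes A :: "'a::real_normed_vector \<Rightarrow>\<^sub>L 'a" and B :: "real \<Rightarrow> 'a \<Rightarrow>\<^sub>L 'a" and \<phi> :: "'a \<Rightarrow>\<^sub>L real"
    and \<mu> :: "real \<Rightarrow> complex"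
  assumes B: "(B \<longlongrightarrow> B0) (at_right 0)" and \<mu>: "(\<mu> \<longlongrightarrow> 0) (at_right 0)"
    and e: "A e = 0" "\<phi> e = 1" and \<phi>A: "\<And>h. \<phi> (A h) = 0"
    and c: "c > 0" "\<And>k. \<phi> k = 0 \<Longrightarrow> c * norm k \<le> norm (A k)"
    and eig: "\<forall>\<^sub>F \<epsilon> in at_right 0. \<exists>x y. (x \<noteq> 0 \<or> y \<noteq> 0) \<and>
      A x + \<epsilon> *\<^sub>R B \<epsilon> x = Re (\<mu> \<epsilon>) *\<^sub>R x - Im (\<mu> \<epsilon>) *\<^sub>R y \<and>
      A y + \<epsilon> *\<^sub>R B \<epsilon> y = Im (\<mu> \<epsilon>) *\<^sub>R x + Re (\<mu> \<epsilon>) *\<^sub>R y"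
  shows "((\<lambda>\<epsilon>. \<mu> \<epsilon> / of_real \<epsilon>) \<longlongrightarrow> of_real (\<phi> (B0 e))) (at_right 0)"
proof -
  define \<delta> where "\<delta> \<epsilon> = norm (\<mu> \<epsilon>) + \<epsilon> * norm (B \<epsilon>)" for \<epsilon>
  \<comment> \<open>The constant arises from
    \<open>c * s \<le> 2 * \<delta> \<epsilon> * (norm e + s)\<close>, where \<open>s\<close> is
    \<open>norm (X - e) + norm Y\<close>: for \<delta> below \<open>c / 4\<close>, the term in
    \<open>s\<close> on the right is absorbed into the left.\<close>
  define r where "r \<epsilon> = 4 * \<delta> \<epsilon> * norm e / c" for \<epsilon>
  have \<delta>0: "(\<delta> \<longlongrightarrow> 0) (at_right 0)"
  proof -
    have "(\<delta> \<longlongrightarrow> norm (0::complex) + 0 * norm B0) (at_right 0)"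
      unfolding \<delta>_def by (intro tendsto_intros B \<mu>)
    then show ?thesis by simp
  qed
  have r0: "(r \<longlongrightarrow> 0) (at_right 0)"
  proof -
    have "(r \<longlongrightarrow> 4 * 0 * norm e / c) (at_right 0)"
      unfolding r_def using c(1) by (intro tendsto_intros \<delta>0) auto
    then show ?thesis by simp
  qed
  have small: "\<forall>\<^sub>F \<epsilon> in at_right 0. \<delta> \<epsilon> < c / 4"
    using order_tendstoD(2)[OF \<delta>0, of "c / 4"] c(1) by simp
  have pos: "\<forall>\<^sub>F \<epsilon> in at_right (0::real). \<epsilon> > 0"
    by (simp add: eventually_at_right_less)
  have key: "\<forall>\<^sub>F \<epsilon> in at_right 0. \<exists>x y. norm (x - e) \<le> r \<epsilon> \<and> norm y \<le> r \<epsilon> \<and>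
      \<mu> \<epsilon> / of_real \<epsilon> = Complex (\<phi> (B \<epsilon> x)) (\<phi> (B \<epsilon> y))"
    using eig small pos
  proof eventually_elim
    case (elim \<epsilon>)
    define a b where "a = Re (\<mu> \<epsilon>)" and "b = Im (\<mu> \<epsilon>)"
    have ab: "\<bar>a\<bar> \<le> norm (\<mu> \<epsilon>)" "\<bar>b\<bar> \<le> norm (\<mu> \<epsilon>)"
      by (simp_all add: a_def b_def abs_Re_le_cmod abs_Im_le_cmod)
    have \<delta>_nonneg: "0 \<le> \<delta> \<epsilon>"
      using elim(3) by (simp add: \<delta>_def)
    obtain x y where nz: "x \<noteq> 0 \<or> y \<noteq> 0"
      and x: "A x + \<epsilon> *\<^sub>R B \<epsilon> x = a *\<^sub>R x - b *\<^sub>R y"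
      and y: "A y + \<epsilon> *\<^sub>R B \<epsilon> y = b *\<^sub>R x + a *\<^sub>R y"
      using elim(1) unfolding a_def b_def by blast
    \<comment> \<open>The coefficient \<open>s\<close> lets one estimate serve both real equations,
      with \<open>s = - b\<close> for the first and \<open>s = b\<close> for the second.\<close>
    have bound: "norm (A x') \<le> \<delta> \<epsilon> * (norm x' + norm y')"
      if "A x' + \<epsilon> *\<^sub>R B \<epsilon> x' = a *\<^sub>R x' + s *\<^sub>R y'" "\<bar>s\<bar> = \<bar>b\<bar>" for x' y' s
    proof -
      have "A x' = a *\<^sub>R x' + s *\<^sub>R y' - \<epsilon> *\<^sub>R B \<epsilon> x'"
        using that(1) by (simp add: algebra_simps)
      then have "norm (A x') \<le> norm (a *\<^sub>R x') + norm (s *\<^sub>R y') + norm (\<epsilon> *\<^sub>R B \<epsilon> x')"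
        using norm_triangle_ineq4[of "a *\<^sub>R x' + s *\<^sub>R y'" "\<epsilon> *\<^sub>R B \<epsilon> x'"]
          norm_triangle_ineq[of "a *\<^sub>R x'" "s *\<^sub>R y'"] by simp
      also have "\<dots> \<le> norm (\<mu> \<epsilon>) * norm x' + norm (\<mu> \<epsilon>) * norm y'
          + \<epsilon> * (norm (B \<epsilon>) * norm x')"
        using that(2) ab elim(3) by (intro add_mono) (auto intro!: mult_mono norm_blinfun)
      also have "\<dots> \<le> \<delta> \<epsilon> * (norm x' + norm y')"
        using elim(3) by (simp add: \<delta>_def algebra_simps)
      finally show ?thesis .
    qed
    define d where "d = (\<phi> x)\<^sup>2 + (\<phi> y)\<^sup>2"
    \<comment> \<open>If \<phi> vanished on both parts, the lower bound of \<open>A\<close> on its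
      kernel would exceed the size of the perturbation.\<close>
    have "d \<noteq> 0"
    proof
      assume "d = 0"
      then have "\<phi> x = 0" "\<phi> y = 0"
        by (simp_all add: d_def sum_power2_eq_zero_iff)
      then have "c * norm x \<le> \<delta> \<epsilon> * (norm x + norm y)" "c * norm y \<le> \<delta> \<epsilon> * (norm y + norm x)"
        using c(2) bound[of x "- b" y] bound[of y b x] x y by (force simp: algebra_simps)+
      then have "c * (norm x + norm y) \<le> (2 * \<delta> \<epsilon>) * (norm x + norm y)"
        by (simp add: algebra_simps)
      then have "(c - 2 * \<delta> \<epsilon>) * (norm x + norm y) \<le> 0"
        by (simp add: algebra_simps)
      moreover have "norm x + norm y > 0"
        using nz by (auto simp: add_pos_nonneg add_nonneg_pos)
      ultimately show False
        using elim(2) c(1) by (simp add: mult_le_0_iff)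
    qed
    \<comment> \<open>\<open>X + i Y\<close> is the eigenvector \<open>x + i y\<close> divided by the complex number \<open>\<phi> x + i \<phi> y\<close>.\<close>
    define X Y where "X = (1 / d) *\<^sub>R (\<phi> x *\<^sub>R x + \<phi> y *\<^sub>R y)"
      and "Y = (1 / d) *\<^sub>R (\<phi> x *\<^sub>R y - \<phi> y *\<^sub>R x)"
    have "\<phi> X = (1 / d) * d" and \<phi>Y: "\<phi> Y = 0"
      by (simp_all add: X_def Y_def blinfun.bilinear_simps d_def power2_eq_square)
    then have \<phi>X: "\<phi> X = 1"
      using \<open>d \<noteq> 0\<close> by simp
    have Ax: "A x = a *\<^sub>R x - b *\<^sub>R y - \<epsilon> *\<^sub>R B \<epsilon> x" and Ay: "A y = b *\<^sub>R x + a *\<^sub>R y - \<epsilon> *\<^sub>R B \<epsilon> y"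
      using x y by (simp_all add: algebra_simps)
    have X: "A X + \<epsilon> *\<^sub>R B \<epsilon> X = a *\<^sub>R X - b *\<^sub>R Y"
      by (simp add: X_def Y_def blinfun.bilinear_simps Ax Ay algebra_simps)
    have Y: "A Y + \<epsilon> *\<^sub>R B \<epsilon> Y = b *\<^sub>R X + a *\<^sub>R Y"
      by (simp add: X_def Y_def blinfun.bilinear_simps Ax Ay algebra_simps)
    define s where "s = norm (X - e) + norm Y"
    have "norm X \<le> norm (X - e) + norm e"
      using norm_triangle_ineq[of "X - e" e] by simp
    then have *: "\<delta> \<epsilon> * (norm X + norm Y) \<le> \<delta> \<epsilon> * (norm e + s)"
      by (intro mult_left_mono \<delta>_nonneg) (simp add: s_def)
    \<comment> \<open>The normalisation puts \<open>X - e\<close> and \<open>Y\<close> into the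
      kernel of \<phi>, and \<open>A (X - e) = A X\<close>.\<close>
    have "c * norm (X - e) \<le> \<delta> \<epsilon> * (norm X + norm Y)"
      using c(2)[of "X - e"] bound[of X "- b" Y] X by (simp add: blinfun.bilinear_simps \<phi>X e)
    moreover have "c * norm Y \<le> \<delta> \<epsilon> * (norm X + norm Y)"
      using c(2)[of Y] bound[of Y b X] Y by (simp add: \<phi>Y algebra_simps)
    ultimately have "c * s \<le> 2 * \<delta> \<epsilon> * (norm e + s)"
      using * by (simp add: s_def algebra_simps)
    moreover have "2 * \<delta> \<epsilon> * s \<le> c / 2 * s"
      using elim(2) by (intro mult_right_mono) (auto simp: s_def)
    ultimately have "c / 2 * s \<le> 2 * \<delta> \<epsilon> * norm e"
      by (simp add: algebra_simps)
    then have "s \<le> r \<epsilon>"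
      using c(1) by (simp add: r_def field_simps)
    moreover have "\<epsilon> * \<phi> (B \<epsilon> X) = a" "\<epsilon> * \<phi> (B \<epsilon> Y) = b"
      using arg_cong[OF X, of \<phi>] arg_cong[OF Y, of \<phi>]
      by (simp_all add: blinfun.bilinear_simps \<phi>A \<phi>X \<phi>Y)
    ultimately show ?case
      using elim(3) by (intro exI[of _ X] exI[of _ Y])
        (auto simp: complex_eq_iff a_def b_def s_def field_simps intro: order_trans[OF _ \<open>s \<le> r \<epsilon>\<close>])
  qed
  then obtain x y where xy: "\<forall>\<^sub>F \<epsilon> in at_right 0. norm (x \<epsilon> - e) \<le> r \<epsilon> \<and> norm (y \<epsilon>) \<le> r \<epsilon> \<and>
      \<mu> \<epsilon> / of_real \<epsilon> = Complex (\<phi> (B \<epsilon> (x \<epsilon>))) (\<phi> (B \<epsilon> (y \<epsilon>)))"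
    unfolding eventually_ex by blast
  have "((\<lambda>\<epsilon>. x \<epsilon> - e) \<longlongrightarrow> 0) (at_right 0)" and y: "(y \<longlongrightarrow> 0) (at_right 0)"
    using xy by (auto intro!: Lim_null_comparison[OF _ r0] elim: eventually_mono)
  then have x: "(x \<longlongrightarrow> e) (at_right 0)"
    using LIM_zero_cancel by blast
  \<comment> \<open>Each eigenvalue may be non-real, but \<open>y\<close> tends to 0, so the
    imaginary part of the quotient vanishes in the limit.\<close>
  have "((\<lambda>\<epsilon>. Complex (\<phi> (B \<epsilon> (x \<epsilon>))) (\<phi> (B \<epsilon> (y \<epsilon>)))) \<longlongrightarrow> Complex (\<phi> (B0 e)) (\<phi> (B0 0))) (at_right 0)"
    by (intro tendsto_Complex blinfun.tendsto tendsto_const B x y)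
  moreover have "Complex (\<phi> (B0 e)) (\<phi> (B0 0)) = of_real (\<phi> (B0 e))"
    by (simp add: complex_eq_iff blinfun.bilinear_simps)
  ultimately show ?thesis
    using tendsto_cong[OF eventually_mono[OF xy]] by force
qed

section \<open>Expansion of the Jacobian along the family of zeros\<close>

lemma jacobian_mult:
  assumes "(f has_derivative f') (at (z::real^'n))"
  shows "jacobian f (at z) *v h = f' h"
proof -
  have "f' = frechet_derivative f (at z)"
    using assms by (rule frechet_derivative_at)
  then show ?thesis
    using has_derivative_linear[OF assms] by (simp add: jacobian_def matrix_works)
qed

text \<open>The slice at height \<open>t\<close> is the image of the whole space, so the partial
  derivative is two-sided even when \<open>t\<close> is an endpoint of \<open>T\<close>.\<close>

lemma has_derivative_partial:
  assumes "Q differentiable_on UNIV \<times> T" "t \<in> T"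
  shows "((\<lambda>u. Q (u, t)) has_derivative (\<lambda>h. fderiv Q (UNIV \<times> T) (z, t) (h, 0))) (at z)"
proof -
  have "(Q has_derivative fderiv Q (UNIV \<times> T) (z, t)) (at (z, t) within (\<lambda>u. (u, t)) ` UNIV)"
    using has_derivative_fderiv[OF assms(1), of "(z, t)"] assms(2)
    by (auto elim: has_derivative_subset)
  moreover have "((\<lambda>u. (u, t)) has_derivative (\<lambda>h. (h, 0))) (at z)"
    by (auto intro!: derivative_eq_intros)
  ultimately show ?thesis
    by (rule has_derivative_in_compose[rotated])
qed

text \<open>The direction varies with \<epsilon>, so a directional derivative would not suffice; the
  Frechet remainder is controlled along any path approaching \<open>z\<close>.\<close>

lemma tendsto_difference_quotient:
  assumes D: "(F has_derivative D) (at z)" and w: "(w \<longlongrightarrow> w0) (at_right 0)"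
  shows "((\<lambda>\<epsilon>. (1 / \<epsilon>) *\<^sub>R (F (z + \<epsilon> *\<^sub>R w \<epsilon>) - F z)) \<longlongrightarrow> D w0) (at_right (0::real))"
proof -
  have lin: "bounded_linear D"
    using D by (rule has_derivative_bounded_linear)
  \<comment> \<open>The value 0 at \<open>z\<close> makes the normalised remainder continuous there
    and covers parameters with \<open>w \<epsilon> = 0\<close>.\<close>
  define E where "E y = (if y = z then 0 else (1 / norm (y - z)) *\<^sub>R (F y - (F z + D (y - z))))" for y
  have "(E \<longlongrightarrow> 0) (at z)"
    using D unfolding has_derivative_at2
    by (subst tendsto_cong[where g = "\<lambda>y. (1 / norm (y - z)) *\<^sub>R (F y - (F z + D (y - z)))"])
      (auto simp: E_def eventually_at_filter)
  then have "isCont E z"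
    by (simp add: isCont_def E_def)
  moreover have "((\<lambda>\<epsilon>. z + \<epsilon> *\<^sub>R w \<epsilon>) \<longlongrightarrow> z + 0 *\<^sub>R w0) (at_right 0)"
    by (intro tendsto_intros w)
  ultimately have E: "((\<lambda>\<epsilon>. E (z + \<epsilon> *\<^sub>R w \<epsilon>)) \<longlongrightarrow> 0) (at_right 0)"
    using isCont_tendsto_compose[of z E] by (force simp: E_def)
  have "((\<lambda>\<epsilon>. D (w \<epsilon>) + norm (w \<epsilon>) *\<^sub>R E (z + \<epsilon> *\<^sub>R w \<epsilon>)) \<longlongrightarrow> D w0 + norm w0 *\<^sub>R 0) (at_right 0)"
    by (intro tendsto_intros w E bounded_linear.tendsto[OF lin])
  moreover have "D (w \<epsilon>) + norm (w \<epsilon>) *\<^sub>R E (z + \<epsilon> *\<^sub>R w \<epsilon>) = (1 / \<epsilon>) *\<^sub>R (F (z + \<epsilon> *\<^sub>R w \<epsilon>) - F z)"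
    if "\<epsilon> > 0" for \<epsilon>
    using that by (simp add: E_def algebra_simps linear_cmul[OF bounded_linear.linear[OF lin]]
      linear_0[OF bounded_linear.linear[OF lin]])
  then have "\<forall>\<^sub>F \<epsilon> in at_right 0. D (w \<epsilon>) + norm (w \<epsilon>) *\<^sub>R E (z + \<epsilon> *\<^sub>R w \<epsilon>)
      = (1 / \<epsilon>) *\<^sub>R (F (z + \<epsilon> *\<^sub>R w \<epsilon>) - F z)"
    by (rule eventually_mono[OF eventually_at_right_less])
  ultimately show ?thesis
    by (simp add: Lim_transform_eventually)
qed


lemma complex_mat_eigenvalueE:
  fixes M :: "real^'n^'n"
  assumes "mat_eigenvalue (map_matrix complex_of_real M) c"
  obtains x y where "x \<noteq> 0 \<or> y \<noteq> 0"
    and "M *v x = Re c *\<^sub>R x - Im c *\<^sub>R y" and "M *v y = Im c *\<^sub>R x + Re c *\<^sub>R y"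
proof -
  obtain h where h: "h \<noteq> 0" "map_matrix complex_of_real M *v h = c *s h"
    using assms by (auto simp: mat_eigenvalue_def)
  have row: "(\<Sum>j\<in>UNIV. complex_of_real (M $ i $ j) * h $ j) = c * h $ i" for i
    using h(2) by (simp add: vec_eq_iff matrix_vector_mult_def map_matrix_def)
  define x y where "x = (\<chi> i. Re (h $ i))" and "y = (\<chi> i. Im (h $ i))"
  have "x \<noteq> 0 \<or> y \<noteq> 0"
    using h(1) by (auto simp: x_def y_def vec_eq_iff complex_eq_iff)
  moreover have "M *v x = Re c *\<^sub>R x - Im c *\<^sub>R y"
    using arg_cong[OF row, of Re] by (simp add: x_def y_def vec_eq_iff matrix_vector_mult_def)
  moreover have "M *v y = Im c *\<^sub>R x + Re c *\<^sub>R y"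
    using arg_cong[OF row, of Im] by (simp add: x_def y_def vec_eq_iff matrix_vector_mult_def)
  ultimately show thesis
    by (rule that)
qed

text \<open>The expansion is exact: \<open>B \<epsilon>\<close> is the difference quotient of the
  derivative of \<open>P\<close> plus the partial derivative of \<open>Q\<close>. It converges by
  differentiability of the former and continuity of the latter.\<close>

lemma Phi_v_expansion:
  fixes P :: "real^'n \<Rightarrow> real^'n" and Q :: "(real^'n) \<times> real \<Rightarrow> real^'n"
    and v0 w0 :: "real^'n"
  assumes P: "C2_on UNIV P" and Q: "C1_on (UNIV \<times> {0..1}) Q"
    and w: "(w \<longlongrightarrow> w0) (at_right 0)"
  obtains B :: "real \<Rightarrow> (real^'n) \<Rightarrow>\<^sub>L (real^'n)" and B0
  where "(B \<longlongrightarrow> B0) (at_right 0)"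
    and "\<And>h. B0 h = second_deriv P v0 w0 h + Q_v Q v0 0 *v h"
    and "\<forall>\<^sub>F \<epsilon> in at_right 0. \<forall>h.
      Phi_v P Q (v0 + \<epsilon> *\<^sub>R w \<epsilon>) \<epsilon> *v h = fderiv P UNIV v0 h + \<epsilon> *\<^sub>R B \<epsilon> h"
proof -
  let ?S = "UNIV \<times> {0..1} :: ((real^'n) \<times> real) set"
  define F where "F = fderiv P UNIV"
  \<comment> \<open>Composition with the embedding \<open>J\<close> turns the full derivative of
    \<open>Q\<close> into its partial one, so continuity carries over in operator norm.\<close>
  define J :: "(real^'n) \<Rightarrow>\<^sub>L ((real^'n) \<times> real)" where "J = Blinfun (\<lambda>h. (h, 0))"
  have J: "J h = (h, 0)" for h
    unfolding J_def by (subst bounded_linear_Blinfun_apply)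
      (auto intro!: bounded_linear_Pair bounded_linear_ident bounded_linear_zero)
  define G where "G z = fderiv Q ?S z o\<^sub>L J" for z
  have G: "blinfun_apply (G z) = (\<lambda>h. fderiv Q ?S z (h, 0))" for z
    by (simp add: G_def J fun_eq_iff)
  define B where "B \<epsilon> = (1 / \<epsilon>) *\<^sub>R (F (v0 + \<epsilon> *\<^sub>R w \<epsilon>) - F v0) + G (v0 + \<epsilon> *\<^sub>R w \<epsilon>, \<epsilon>)" for \<epsilon>
  define B0 where "B0 = fderiv F UNIV v0 w0 + G (v0, 0)"
  have diffP: "P differentiable_on UNIV" and diffF: "F differentiable_on UNIV"
    using P by (auto simp: C2_on_def C1_on_def F_def)
  have diffQ: "Q differentiable_on ?S" and contQ: "continuous_on ?S (fderiv Q ?S)"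
    using Q by (auto simp: C1_on_def)
  have in_S: "\<forall>\<^sub>F \<epsilon> in at_right 0. 0 < \<epsilon> \<and> \<epsilon> < (1::real)"
    using eventually_at_right_real[of 0 1] by simp
  have Qv: "Q_v Q z \<epsilon> *v h = G (z, \<epsilon>) h"
    and Phiv: "Phi_v P Q z \<epsilon> *v h = F z h + \<epsilon> *\<^sub>R G (z, \<epsilon>) h" if "\<epsilon> \<in> {0..1}" for z \<epsilon> h
  proof -
    have DQ: "((\<lambda>u. Q (u, \<epsilon>)) has_derivative G (z, \<epsilon>)) (at z)"
      using has_derivative_partial[OF diffQ that] by (simp add: G)
    then show "Q_v Q z \<epsilon> *v h = G (z, \<epsilon>) h"
      by (simp add: Q_v_def jacobian_mult)
    have "(P has_derivative F z) (at z)"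
      using has_derivative_fderiv[OF diffP] by (simp add: F_def)
    then have "((\<lambda>u. Phi P Q u \<epsilon>) has_derivative (\<lambda>h. F z h + \<epsilon> *\<^sub>R G (z, \<epsilon>) h)) (at z)"
      unfolding Phi_def by (intro has_derivative_add has_derivative_scaleR_right DQ)
    then show "Phi_v P Q z \<epsilon> *v h = F z h + \<epsilon> *\<^sub>R G (z, \<epsilon>) h"
      by (simp add: Phi_v_def jacobian_mult)
  qed
  have "((\<lambda>\<epsilon>. (v0 + \<epsilon> *\<^sub>R w \<epsilon>, \<epsilon>)) \<longlongrightarrow> (v0 + 0 *\<^sub>R w0, 0)) (at_right 0)"
    by (intro tendsto_intros w)
  then have "((\<lambda>\<epsilon>. fderiv Q ?S (v0 + \<epsilon> *\<^sub>R w \<epsilon>, \<epsilon>)) \<longlongrightarrow> fderiv Q ?S (v0, 0)) (at_right 0)"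
    by (intro continuous_on_tendsto_compose[OF contQ])
      (auto intro: eventually_mono[OF in_S])
  then have "(B \<longlongrightarrow> B0) (at_right 0)"
    unfolding B_def B0_def G_def
    using has_derivative_fderiv[OF diffF, of v0]
    by (intro tendsto_add tendsto_difference_quotient w tendsto_intros) auto
  moreover have "B0 h = second_deriv P v0 w0 h + Q_v Q v0 0 *v h" for h
    by (simp add: B0_def Qv second_deriv_def F_def blinfun.add_left)
  moreover have "\<forall>\<^sub>F \<epsilon> in at_right 0. \<forall>h.
      Phi_v P Q (v0 + \<epsilon> *\<^sub>R w \<epsilon>) \<epsilon> *v h = fderiv P UNIV v0 h + \<epsilon> *\<^sub>R B \<epsilon> h"
    using in_S
    by eventually_elim (auto simp: Phiv B_def F_def[symmetric] blinfun.bilinear_simps algebra_simps)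
  ultimately show thesis
    by (rule that)
qed

section \<open>The eigenvalue asymptotics\<close>

theorem theorem2:
  fixes P :: "real^'n \<Rightarrow> real^'n"
    and Q :: "(real^'n) \<times> real \<Rightarrow> real^'n"
    and Pr :: "real^'n \<Rightarrow> real^'n"
    and x :: "real \<Rightarrow> real^'n"
    and I :: "real set"
    and \<theta>0 :: real
    and v0 w0 :: "real^'n"
    and w :: "real \<Rightarrow> real^'n"
    and ev :: "real \<Rightarrow> complex"
    and lam :: real
  assumes "C2_on UNIV P"
    and "C1_on (UNIV \<times> {0..1}) Q"
    and "P v0 = 0"
    and "\<not> invertible (jacobian P (at v0))"
    and "simple_mat_eigenvalue (jacobian P (at v0)) 0"
    and "is_interval I" and "open I" and "\<theta>0 \<in> I"
    and "C2_on I x"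
    and "\<forall>\<theta>\<in>I. P (x \<theta>) = 0"
    and "v0 = x \<theta>0"
    and "invariant_projector Pr ((*v) (jacobian P (at v0)))"
    and "\<forall>h. Pr (jacobian P (at v0) *v h) = 0"
    and "bij_betw ((*v) (jacobian P (at v0)))
           (range (complement_proj Pr)) (range (complement_proj Pr))"
    and "Pr (Q (v0, 0)) = 0"
    and "\<forall>r s. Pr (second_deriv P v0 (Pr r) (Pr s)) = 0"
    and "bij_betw
           (\<lambda>h. - Pr (second_deriv P v0
                      (complement_proj Pr
                        (inv_into (range (complement_proj Pr)) ((*v) (jacobian P (at v0)))
                          (Q (v0, 0)))) h)
                + Pr (Q_v Q v0 0 *v h))
           (range Pr) (range Pr)"
    and "Psi P Q Pr v0 w0 0 = 0"
    and "\<forall>\<^sub>F \<epsilon> in at_right 0. Psi P Q Pr v0 (w \<epsilon>) \<epsilon> = 0"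
    and "(w \<longlongrightarrow> w0) (at_right 0)"
    and "\<forall>\<^sub>F \<epsilon> in at_right 0.
           mat_eigenvalue (map_matrix complex_of_real (Phi_v P Q (v0 + \<epsilon> *\<^sub>R w \<epsilon>) \<epsilon>)) (ev \<epsilon>)"
    and "(ev \<longlongrightarrow> 0) (at_right 0)"
    and "eigenvalue_on (range Pr)
           (\<lambda>h. Pr (second_deriv P v0 w0 h) + Pr (Q_v Q v0 0 *v h)) lam"
  shows "(\<lambda>\<epsilon>. ev \<epsilon> - complex_of_real (\<epsilon> * lam))
           \<in> o[at_right 0](\<lambda>\<epsilon>. complex_of_real \<epsilon>)"
proof -
  define A where "A = fderiv P UNIV v0"
  have "(P has_derivative A) (at v0)"
    using assms(1) has_derivative_fderiv[of P UNIV v0] by (simp add: A_def C2_on_def)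
  then have A: "jacobian P (at v0) *v h = A h" for h
    by (rule jacobian_mult)
  have lin: "linear Pr" and idem: "Pr (Pr h) = Pr h"
    and A_range: "A ` range Pr \<subseteq> range Pr" for h
    using assms(12) by (auto simp: invariant_projector_def linear_projector_def A fun_eq_iff)
  have PrA: "Pr (A h) = 0" for h
    using assms(13) by (simp add: A)
  \<comment> \<open>By invariance \<open>A (Pr h)\<close> is fixed by \<open>Pr\<close>, which also
    annihilates every value of \<open>A\<close>.\<close>
  have APr: "A (Pr h) = 0" for h
  proof -
    obtain g where "A (Pr h) = Pr g"
      using A_range by blast
    then have "A (Pr h) = Pr (A (Pr h))"
      by (simp add: idem)
    then show ?thesis
      by (simp add: PrA)
  qed
  have A_inj: "h = 0" if "Pr h = 0" "A h = 0" for h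
  proof -
    have "inj_on A (range (complement_proj Pr))"
      using assms(14) by (auto simp: bij_betw_def inj_on_def A)
    moreover have "h = complement_proj Pr h" "0 = complement_proj Pr 0"
      using that linear_0[OF lin] by (simp_all add: complement_proj_def)
    ultimately show "h = 0"
      using that(2) by (metis blinfun.zero_right inj_onD rangeI)
  qed
  obtain B :: "real \<Rightarrow> (real^'n) \<Rightarrow>\<^sub>L (real^'n)" and B0 where B: "(B \<longlongrightarrow> B0) (at_right 0)"
    and B0: "\<And>h. B0 h = second_deriv P v0 w0 h + Q_v Q v0 0 *v h"
    and expand: "\<forall>\<^sub>F \<epsilon> in at_right 0. \<forall>h.
      Phi_v P Q (v0 + \<epsilon> *\<^sub>R w \<epsilon>) \<epsilon> *v h = A h + \<epsilon> *\<^sub>R B \<epsilon> h"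
    using Phi_v_expansion[where ?v0.0 = v0, OF assms(1,2,20)] unfolding A_def by blast
  \<comment> \<open>The eigenvector for \<open>lam\<close> is taken as spanning vector of the range
    of \<open>Pr\<close>, with \<phi> below as the coordinate along it, so \<phi> of
    \<open>B0 e\<close> is \<open>lam\<close>.\<close>
  obtain e where e: "e \<in> range Pr" "e \<noteq> 0" and PrB0e: "Pr (B0 e) = lam *\<^sub>R e"
    using assms(23) by (auto simp: eigenvalue_on_def B0 linear_add[OF lin])
  define \<phi> where "\<phi> = Blinfun (\<lambda>h. Pr h \<bullet> e / (e \<bullet> e))"
  have "linear (\<lambda>h. Pr h \<bullet> e / (e \<bullet> e))"
    by (rule linearI)
      (simp_all add: linear_add[OF lin] linear_cmul[OF lin] inner_add_left add_divide_distrib)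
  then have \<phi>: "\<phi> h = Pr h \<bullet> e / (e \<bullet> e)" for h
    unfolding \<phi>_def by (subst bounded_linear_Blinfun_apply) (simp_all add: linear_conv_bounded_linear)
  have Pr_e: "Pr e = e"
    using e(1) idem by auto
  have Pr_eq: "Pr h = \<phi> h *\<^sub>R e" for h
  proof -
    \<comment> \<open>Both \<open>Pr h\<close> and \<open>e\<close> lie in the kernel of
      \<open>A\<close>, a line by simplicity of the eigenvalue 0.\<close>
    have "Pr h \<in> span {e}"
      by (rule simple_mat_eigenvalue_eigenspace[OF assms(5)]) (use APr[of h] APr[of e] Pr_e e(2) in \<open>simp_all add: A\<close>)
    then show ?thesis
      using e(2) by (auto simp: span_singleton \<phi>)
  qed
  have lin_sum: "linear (\<lambda>h. A h + Pr h)"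
    by (intro linear_compose_add lin blinfun.bounded_linear_right[THEN bounded_linear.linear])
  \<comment> \<open>An injective map in finite dimension is bounded below; on the kernel of \<phi>,
    where \<open>Pr\<close> vanishes, this becomes the lower bound for \<open>A\<close>.\<close>
  have "inj (\<lambda>h. A h + Pr h)"
  proof (rule linear_injective_0[OF lin_sum, THEN iffD2])
    show "\<forall>h. A h + Pr h = 0 \<longrightarrow> h = 0"
    proof (intro allI impI)
      fix h
      assume *: "A h + Pr h = 0"
      then have "Pr (A h + Pr h) = 0"
        by (simp add: linear_0[OF lin])
      then have "Pr h = 0"
        by (simp add: linear_add[OF lin] PrA idem)
      then show "h = 0"
        using * A_inj by simp
    qed
  qed
  then obtain c where c: "c > 0" "\<And>h. c * norm h \<le> norm (A h + Pr h)"
    using linear_inj_bounded_below_pos[OF lin_sum] by blast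
  have "((\<lambda>\<epsilon>. ev \<epsilon> / of_real \<epsilon>) \<longlongrightarrow> of_real (\<phi> (B0 e))) (at_right 0)"
  proof (rule simple_eigenvalue_perturbation[OF B assms(22) _ _ _ c(1)])
    show "A e = 0"
      using APr[of e] by (simp add: Pr_e)
    show "\<phi> e = 1" "\<phi> (A h) = 0" for h
      using e(2) by (simp_all add: \<phi> Pr_e PrA)
    show "c * norm k \<le> norm (A k)" if "\<phi> k = 0" for k
      using c(2)[of k] that by (simp add: Pr_eq)
    show "\<forall>\<^sub>F \<epsilon> in at_right 0. \<exists>x y. (x \<noteq> 0 \<or> y \<noteq> 0) \<and>
      A x + \<epsilon> *\<^sub>R B \<epsilon> x = Re (ev \<epsilon>) *\<^sub>R x - Im (ev \<epsilon>) *\<^sub>R y \<and>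
      A y + \<epsilon> *\<^sub>R B \<epsilon> y = Im (ev \<epsilon>) *\<^sub>R x + Re (ev \<epsilon>) *\<^sub>R y"
      using assms(21) expand
    proof eventually_elim
      case (elim \<epsilon>)
      then show ?case
        by (elim complex_mat_eigenvalueE) auto
    qed
  qed
  moreover have "\<phi> (B0 e) = lam"
    using e(2) by (simp add: \<phi> PrB0e)
  ultimately have "((\<lambda>\<epsilon>. ev \<epsilon> / of_real \<epsilon> - of_real lam) \<longlongrightarrow> 0) (at_right 0)"
    using LIM_zero by force
  moreover have "\<forall>\<^sub>F \<epsilon> in at_right 0. ev \<epsilon> / of_real \<epsilon> - of_real lam
      = (ev \<epsilon> - complex_of_real (\<epsilon> * lam)) / complex_of_real \<epsilon>"
    by (rule eventually_mono[OF eventually_at_right_less]) (simp add: field_simps)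
  ultimately have "((\<lambda>\<epsilon>. (ev \<epsilon> - complex_of_real (\<epsilon> * lam)) / complex_of_real \<epsilon>) \<longlongrightarrow> 0) (at_right 0)"
    by (rule Lim_transform_eventually)
  then show ?thesis
    by (rule smalloI_tendsto) (auto intro: eventually_mono[OF eventually_at_right_less])
qed

end
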